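(* Let $G=(V,E)$ be a connected amply regular graph with parameters $(n,d,\alpha,\beta)$ (with $n=\infty$ allowed), neither complete nor empty. Let $x\in V$ and let $A_{S_1(x)}$ be the adjacency matrix of the subgraph of $G$ induced by the set $S_1(x)$ of neighbors of $x$. Then $$K_{BE}(+,x)=2+\frac{\alpha}{2}+\left(\frac{2d(\beta-2)-\alpha^2}{2\beta}+\frac{2}{\beta}\min_{\lambda\in\mathrm{sp}(A_{S_1(x)})}\left(\lambda-\frac{\alpha}{2}\right)^2\right)_-,$$ where the minimum is taken over all eigenvalues $\lambda$ of $A_{S_1(x)}$ and $a_-:=\min\{0,a\}$ for $a\in\mathbb{R}$.
   Context: All graphs are simple and undirected. An amply regular graph with parameters $(n,d,\alpha,\beta)$ is a $d$-regular graph ($d$ finite) with $n$ vertices, $n=\infty$ being allowed, such that any two adjacent vertices have exactly $\alpha$ common neighbors and any two vertices at distance $2$ have exactly $\beta$ common neighbors. Bakry--Émery curvature $K_{BE}(+,x)$: for $f:V\to\mathbb{R}$ let $\Delta f(x)=\sum_{y:\,xy\in E}(f(y)-f(x))$ (non-normalized Laplacian). For $f,g:V\to\mathbb{R}$ define $2\Gamma(f,g)=\Delta(fg)-(\Delta f)g-f(\Delta g)$ and $2\Gamma_2(f,g)=\Delta\Gamma(f,g)-\Gamma(\Delta f,g)-\Gamma(f,\Delta g)$, and write $\Gamma(f)=\Gamma(f,f)$, $\Gamma_2(f)=\Gamma_2(f,f)$. Then $K_{BE}(+,x)$ is the supremum of all $K\in\mathbb{R}$ such that $\Gamma_2(f)(x)\ge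 K\,\Gamma(f)(x)$ for all $f:V\to\mathbb{R}$. *)

theory Defs
  imports
    "Graph_Theory.Graph_Theory"
    "Jordan_Normal_Form.Spectral_Radius"
    "HOL-Library.Extended_Nat"
    "HOL-Library.Extended_Real"
begin

text \<open>
  Simple undirected graphs, possibly infinite, are the structures satisfying
  \<^locale>\<open>pair_bidirected_digraph\<close>: the arc relation \<^const>\<open>parcs\<close> is symmetric, irreflexive
  and contained in \<^term>\<open>pverts G \<times> pverts G\<close>; an undirected edge is a pair of opposite arcs.
\<close>

definition neighbors :: "'a pair_pre_digraph \<Rightarrow> 'a \<Rightarrow> 'a set" where
  "neighbors G x = {y. (x, y) \<in> parcs G}"

text \<open>\<^const>\<open>wf_digraph.\<mu>\<close> with unit weights: the length of a shortest walk, infinite if there is none.\<close>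

definition graph_distance :: "'a pair_pre_digraph \<Rightarrow> 'a \<Rightarrow> 'a \<Rightarrow> ereal" where
  "graph_distance G u v = wf_digraph.\<mu> (with_proj G) (\<lambda>_. 1) u v"

definition number_of_vertices :: "'a pair_pre_digraph \<Rightarrow> enat" where
  "number_of_vertices G = (if finite (pverts G) then enat (card (pverts G)) else \<infinity>)"

definition amply_regular :: "'a pair_pre_digraph \<Rightarrow> enat \<Rightarrow> nat \<Rightarrow> nat \<Rightarrow> nat \<Rightarrow> bool" where
  "amply_regular G n d \<alpha> \<beta> \<longleftrightarrow>
     pair_bidirected_digraph G \<and>
     number_of_vertices G = n \<and>
     (\<forall>u \<in> pverts G. finite (neighbors G u) \<and> card (neighbors G u) = d) \<and>
     (\<forall>u \<in> pverts G. \<forall>v \<in> pverts G.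
        (u, v) \<in> parcs G \<longrightarrow> card (neighbors G u \<inter> neighbors G v) = \<alpha>) \<and>
     (\<forall>u \<in> pverts G. \<forall>v \<in> pverts G.
        graph_distance G u v = 2 \<longrightarrow> card (neighbors G u \<inter> neighbors G v) = \<beta>)"

definition complete_graph :: "'a pair_pre_digraph \<Rightarrow> bool" where
  "complete_graph G \<longleftrightarrow> (\<forall>u \<in> pverts G. \<forall>v \<in> pverts G. u \<noteq> v \<longrightarrow> (u, v) \<in> parcs G)"

definition empty_graph :: "'a pair_pre_digraph \<Rightarrow> bool" where
  "empty_graph G \<longleftrightarrow> parcs G = {}"

text \<open>
  The operators below act on functions on the whole type \<^typ>\<open>'a\<close>. At a vertex their values only
  depend on the values of the functions on \<^term>\<open>pverts G\<close>.
\<close>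

definition laplacian :: "'a pair_pre_digraph \<Rightarrow> ('a \<Rightarrow> real) \<Rightarrow> 'a \<Rightarrow> real" where
  "laplacian G f x = (\<Sum>y \<in> neighbors G x. f y - f x)"

definition Gamma :: "'a pair_pre_digraph \<Rightarrow> ('a \<Rightarrow> real) \<Rightarrow> ('a \<Rightarrow> real) \<Rightarrow> 'a \<Rightarrow> real" where
  "Gamma G f g x =
     (laplacian G (\<lambda>z. f z * g z) x - laplacian G f x * g x - f x * laplacian G g x) / 2"

definition Gamma2 :: "'a pair_pre_digraph \<Rightarrow> ('a \<Rightarrow> real) \<Rightarrow> ('a \<Rightarrow> real) \<Rightarrow> 'a \<Rightarrow> real" where
  "Gamma2 G f g x =
     (laplacian G (Gamma G f g) x - Gamma G (laplacian G f) g x - Gamma G f (laplacian G g) x) / 2"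

text \<open>
  The supremum is taken in the extended reals, so that it is meaningful without knowing
  beforehand that the set of admissible constants is nonempty and bounded above.
\<close>

definition Bakry_Emery_curvature :: "'a pair_pre_digraph \<Rightarrow> 'a \<Rightarrow> ereal" where
  "Bakry_Emery_curvature G x =
     Sup {ereal K | K. \<forall>f :: 'a \<Rightarrow> real. Gamma2 G f f x \<ge> K * Gamma G f f x}"

text \<open>The list \<open>vs\<close> fixes the order of the rows and columns.\<close>

definition adjacency_matrix :: "('a, 'b) pre_digraph \<Rightarrow> 'a list \<Rightarrow> real Matrix.mat" where
  "adjacency_matrix H vs =
     Matrix.mat (length vs) (length vs) (\<lambda>(i, j). if (vs ! i, vs ! j) \<in> arcs_ends H then 1 else 0)"

definition negative_part :: "real \<Rightarrow> real" where
  "negative_part a = min 0 a"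

end

theory Submission
  imports Defs "HOL-Analysis.Function_Topology"
begin

text \<open>
  Normalize \<open>f x = 0\<close>, let \<open>v\<close> be the restriction of \<open>f\<close> to the neighbors of \<open>x\<close> and \<open>A\<close> the
  adjacency operator on them. Completing the square at each vertex \<open>z\<close> at distance 2 from \<open>x\<close>, which
  has exactly \<open>\<beta>\<close> neighbors adjacent to \<open>x\<close>, minimizes \<open>\<Gamma>\<^sub>2 f x\<close> over the values of \<open>f\<close> there and
  leaves a quadratic form in \<open>v\<close>. Counting common neighbors turns it into
  \<open>2 \<Gamma>\<^sub>2 = c |v|\<^sup>2 + (2/\<beta>) |(A - \<alpha>/2) v|\<^sup>2 - (1 - 2/\<beta>) (\<Sum> v)\<^sup>2\<close>, while \<open>2 \<Gamma> = |v|\<^sup>2\<close>.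
  Since \<open>A\<close> maps the constant function 1 to \<open>\<alpha>\<close>, the form splits along the constants, where it has
  eigenvalue \<open>2 + \<alpha>/2\<close>, and their orthogonal complement, where the spectrum of \<open>A\<close> decides.
  The eigenvalue \<open>\<alpha>\<close> of the constants may be included in the minimum: for \<open>\<beta> \<ge> 2\<close> it contributes a
  nonnegative number, and for \<open>\<beta> = 1\<close> it is a multiple eigenvalue because the graph is not complete.
\<close>

section \<open>Variational search for the eigenvalue of a symmetric operator nearest to 0\<close>

text \<open>A small \<open>t\<close> of sign opposite to \<open>a\<close> makes the linear term win:
  \<open>t = - a / c\<close> with \<open>c > b\<close> and \<open>c > 0\<close> gives the negative
  value \<open>(a / c)^2 * (b - 2 * c)\<close>. This serves as the first-order condition at a
  minimum.\<close>

lemma linear_coeff_eq_0: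
  fixes a b :: real
  assumes "\<And>t. 0 \<le> 2 * t * a + t\<^sup>2 * b"
  shows "a = 0"
proof (rule ccontr)
  assume "a \<noteq> 0"
  define c where "c = \<bar>b\<bar> + 1"
  have c: "c > 0" "b < c" by (auto simp: c_def)
  have "0 \<le> 2 * (- a / c) * a + (- a / c)\<^sup>2 * b" by (rule assms)
  also have "\<dots> = (a / c)\<^sup>2 * (b - 2 * c)"
    using c by (simp add: power2_eq_square field_simps)
  also have "\<dots> < 0"
    using c \<open>a \<noteq> 0\<close> by (intro mult_pos_neg) auto
  finally show False by simp
qed

text \<open>The unit sphere is compact, and homogeneity carries the bound from it to all
  \<open>v\<close>. Functions live on the whole type, so \<open>box\<close> pins the coordinates
  outside \<open>S\<close> to 0; the product is then compact by Tychonoff.\<close>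

lemma sphere_minimizer:
  fixes b :: "'a \<Rightarrow> 'a \<Rightarrow> real"
  assumes "finite S" "S \<noteq> {}"
  obtains u where "(\<Sum>i\<in>S. (u i)\<^sup>2) = 1"
    and "\<And>v. (\<Sum>i\<in>S. (\<Sum>j\<in>S. b i j * u j)\<^sup>2) * (\<Sum>i\<in>S. (v i)\<^sup>2)
           \<le> (\<Sum>i\<in>S. (\<Sum>j\<in>S. b i j * v j)\<^sup>2)"
proof -
  define box where "box = (\<lambda>i. if i \<in> S then {-1..1::real} else {0})"
  define C where "C = Pi\<^sub>E UNIV box \<inter> {u. (\<Sum>i\<in>S. (u i)\<^sup>2) = 1}"
  define q where "q v = (\<Sum>i\<in>S. (\<Sum>j\<in>S. b i j * v j)\<^sup>2)" for v
  have "compactin (product_topology (\<lambda>_. euclidean) UNIV) (Pi\<^sub>E UNIV box)"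
    by (subst compactin_PiE) (auto simp: box_def)
  then have "compact (Pi\<^sub>E UNIV box)"
    by (simp add: euclidean_product_topology)
  moreover have "closed {u :: 'a \<Rightarrow> real. (\<Sum>i\<in>S. (u i)\<^sup>2) = 1}"
    by (intro closed_Collect_eq continuous_intros continuous_on_product_coordinates)
  ultimately have "compact C"
    unfolding C_def by (rule compact_Int_closed)
  have in_C: "u \<in> C" if "(\<Sum>i\<in>S. (u i)\<^sup>2) = 1" "\<And>i. i \<notin> S \<Longrightarrow> u i = 0" for u
  proof -
    have "\<bar>u i\<bar> \<le> 1" if "i \<in> S" for i
      using member_le_sum[of i S "\<lambda>i. (u i)\<^sup>2"] that \<open>finite S\<close> \<open>(\<Sum>i\<in>S. (u i)\<^sup>2) = 1\<close>
      by (simp add: abs_square_le_1)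
    then show ?thesis
      using that by (auto simp: C_def box_def abs_le_iff split: if_splits)
  qed
  obtain i0 where "i0 \<in> S" using \<open>S \<noteq> {}\<close> by blast
  have "(\<lambda>i. if i = i0 then 1 else 0) \<in> C"
    using \<open>i0 \<in> S\<close> \<open>finite S\<close> by (intro in_C) (auto simp: if_distrib[of "\<lambda>t. t\<^sup>2"] cong: if_cong)
  then have "C \<noteq> {}" by blast
  have "continuous_on UNIV q"
    unfolding q_def by (intro continuous_intros continuous_on_product_coordinates)
  then have "continuous_on C q"
    by (rule continuous_on_subset) simp
  then obtain u where u: "u \<in> C" "\<And>v. v \<in> C \<Longrightarrow> q u \<le> q v"
    using continuous_attains_inf[OF \<open>compact C\<close> \<open>C \<noteq> {}\<close>] by blast
  have "q u * (\<Sum>i\<in>S. (v i)\<^sup>2) \<le> q v" for v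
  proof (cases "(\<Sum>i\<in>S. (v i)\<^sup>2) = 0")
    case True
    then show ?thesis by (simp add: q_def sum_nonneg)
  next
    case False
    define c where "c = (\<Sum>i\<in>S. (v i)\<^sup>2)"
    have "c > 0" using False by (simp add: c_def sum_nonneg order_less_le)
    define w where "w i = (if i \<in> S then v i / sqrt c else 0)" for i
    have "(\<Sum>i\<in>S. (w i)\<^sup>2) = (\<Sum>i\<in>S. (v i)\<^sup>2 / c)"
      using \<open>c > 0\<close> by (intro sum.cong) (auto simp: w_def power_divide)
    also have "\<dots> = 1" using \<open>c > 0\<close> by (simp add: c_def flip: sum_divide_distrib)
    finally have "w \<in> C" by (intro in_C) (auto simp: w_def)
    have "(\<Sum>j\<in>S. b i j * w j) = (\<Sum>j\<in>S. b i j * v j) / sqrt c" for i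
      by (simp add: w_def sum_divide_distrib)
    then have "q w = q v / c"
      using \<open>c > 0\<close> by (simp add: q_def power_divide flip: sum_divide_distrib)
    then have "q u \<le> q v / c" using u(2)[OF \<open>w \<in> C\<close>] by simp
    then show ?thesis using \<open>c > 0\<close> by (simp add: c_def[symmetric] field_simps)
  qed
  moreover have "(\<Sum>i\<in>S. (u i)\<^sup>2) = 1" using u(1) by (simp add: C_def)
  ultimately show thesis using that by (simp add: q_def)
qed

text \<open>Meant for B = A - \<alpha>/2: minimizing |Bv|^2 leads straight to the eigenvalue of
  least square. Criticality of the minimizer \<open>u\<close> gives \<open>B (B u) = s * u\<close>
  on \<open>S\<close>, and then \<open>u\<close> or (B + r) u is an eigenvector of B.\<close>

lemma symmetric_least_square_eigenvalue:
  fixes b :: "'a \<Rightarrow> 'a \<Rightarrow> real"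
  assumes "finite S" "S \<noteq> {}"
    and sym: "\<And>i j. i \<in> S \<Longrightarrow> j \<in> S \<Longrightarrow> b i j = b j i"
  obtains r u where "\<exists>i\<in>S. u i \<noteq> 0"
    and "\<And>i. i \<in> S \<Longrightarrow> (\<Sum>j\<in>S. b i j * u j) = r * u i"
    and "\<And>v. r\<^sup>2 * (\<Sum>i\<in>S. (v i)\<^sup>2) \<le> (\<Sum>i\<in>S. (\<Sum>j\<in>S. b i j * v j)\<^sup>2)"
proof -
  define B where "B v i = (\<Sum>j\<in>S. b i j * v j)" for v i
  obtain u where u1: "(\<Sum>i\<in>S. (u i)\<^sup>2) = 1"
    and min: "\<And>v. (\<Sum>i\<in>S. (B u i)\<^sup>2) * (\<Sum>i\<in>S. (v i)\<^sup>2) \<le> (\<Sum>i\<in>S. (B v i)\<^sup>2)"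
    using sphere_minimizer[OF assms(1,2), of b] unfolding B_def by blast
  define s where "s = (\<Sum>i\<in>S. (B u i)\<^sup>2)"
  have "s \<ge> 0" by (simp add: s_def sum_nonneg)
  have B_lin: "B (\<lambda>i. f i + t * g i) i = B f i + t * B g i" for f g t i
    by (simp add: B_def algebra_simps sum.distrib sum_distrib_left)
  have self_adj: "(\<Sum>i\<in>S. f i * B g i) = (\<Sum>i\<in>S. B f i * g i)" for f g
  proof -
    have "(\<Sum>i\<in>S. f i * B g i) = (\<Sum>i\<in>S. \<Sum>j\<in>S. f i * (b i j * g j))"
      by (simp add: B_def sum_distrib_left)
    also have "\<dots> = (\<Sum>j\<in>S. \<Sum>i\<in>S. b j i * f i * g j)"
      by (subst sum.swap) (intro sum.cong refl, simp add: sym)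
    finally show ?thesis by (simp add: B_def sum_distrib_right)
  qed
  have sq_expand: "(\<Sum>i\<in>S. (f i + t * g i)\<^sup>2)
      = (\<Sum>i\<in>S. (f i)\<^sup>2) + 2 * t * (\<Sum>i\<in>S. f i * g i) + t\<^sup>2 * (\<Sum>i\<in>S. (g i)\<^sup>2)"
    for f g :: "'a \<Rightarrow> real" and t
    by (simp add: power2_eq_square algebra_simps sum.distrib sum_distrib_left)
  \<comment> \<open>The polynomial in \<open>t\<close> below is |B(u + th)|^2 - s |u + th|^2; its
    constant term vanishes since |u| = 1 and |Bu|^2 = s.\<close>
  have crit: "(\<Sum>i\<in>S. B u i * B h i) - s * (\<Sum>i\<in>S. u i * h i) = 0" for h
  proof (rule linear_coeff_eq_0)
    fix t
    show "0 \<le> 2 * t * ((\<Sum>i\<in>S. B u i * B h i) - s * (\<Sum>i\<in>S. u i * h i))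
        + t\<^sup>2 * ((\<Sum>i\<in>S. (B h i)\<^sup>2) - s * (\<Sum>i\<in>S. (h i)\<^sup>2))"
      using min[of "\<lambda>i. u i + t * h i"] unfolding B_lin sq_expand u1 s_def[symmetric]
      by (simp add: algebra_simps)
  qed
  \<comment> \<open>The residual of the eigenvalue equation is its own test direction:
    self-adjointness turns its squared norm into the vanishing derivative.\<close>
  define h where "h i = B (B u) i - s * u i" for i
  have "(\<Sum>i\<in>S. (h i)\<^sup>2) = (\<Sum>i\<in>S. B (B u) i * h i) - s * (\<Sum>i\<in>S. u i * h i)"
    by (simp add: h_def power2_eq_square left_diff_distrib sum_subtractf sum_distrib_left mult.assoc)
  also have "\<dots> = 0" using crit[of h] by (simp add: self_adj)
  finally have BBu: "B (B u) i = s * u i" if "i \<in> S" for i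
    using that \<open>finite S\<close> by (simp add: sum_nonneg_eq_0_iff h_def)
  have u_ne: "\<exists>i\<in>S. u i \<noteq> 0"
    using u1 by (metis (mono_tags, lifting) power_zero_numeral sum.neutral zero_neq_one)
  have min': "s * (\<Sum>i\<in>S. (v i)\<^sup>2) \<le> (\<Sum>i\<in>S. (\<Sum>j\<in>S. b i j * v j)\<^sup>2)" for v
    using min[of v] by (simp add: s_def B_def)
  define r where "r = sqrt s"
  have "r\<^sup>2 = s" using \<open>s \<ge> 0\<close> by (simp add: r_def)
  have r2: "r * r = s" using \<open>s \<ge> 0\<close> by (simp add: r_def)
  define w where "w i = B u i + r * u i" for i
  \<comment> \<open>\<open>B\<^sup>2 u = r\<^sup>2 u\<close> factors as \<open>(B - r) (B + r) u = 0\<close>, and \<open>w = (B + r) u\<close>.\<close>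
  show thesis
  proof (cases "\<exists>i\<in>S. w i \<noteq> 0")
    case True
    have "B w i = r * w i" if "i \<in> S" for i
      using BBu[OF that] by (simp add: w_def[abs_def] B_lin algebra_simps r2[symmetric])
    then show thesis
      using True min' by (intro that[of w r]) (auto simp: B_def \<open>r\<^sup>2 = s\<close>)
  next
    case False
    then have "B u i = - r * u i" if "i \<in> S" for i
      using that by (auto simp: w_def)
    then show thesis
      using u_ne min' by (intro that[of u "- r"]) (auto simp: B_def \<open>r\<^sup>2 = s\<close>)
  qed
qed

text \<open>Trades vectors indexed by positions in \<open>vs\<close> for functions on
  \<open>set vs\<close>; distinctness makes the indexing a bijection, and the order of
  \<open>vs\<close> drops out.\<close>

lemma spectrum_mat_nth_iff:
  fixes a :: "'a \<Rightarrow> 'a \<Rightarrow> real"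
  assumes "distinct vs"
  shows "l \<in> spectrum (Matrix.mat (length vs) (length vs) (\<lambda>(i, j). a (vs ! i) (vs ! j))) \<longleftrightarrow>
    (\<exists>u. (\<exists>y\<in>set vs. u y \<noteq> 0) \<and> (\<forall>y\<in>set vs. (\<Sum>z\<in>set vs. a y z * u z) = l * u y))"
    (is "_ \<in> spectrum ?A \<longleftrightarrow> ?R")
proof -
  let ?n = "length vs"
  have bij: "bij_betw ((!) vs) {..<?n} (set vs)"
    using assms by (rule bij_betw_nth) auto
  have entry: "(?A *\<^sub>v w) $ i = (\<Sum>z\<in>set vs. a (vs ! i) z * u z)"
    if "i < ?n" "w \<in> carrier_vec ?n" "\<And>k. k < ?n \<Longrightarrow> w $ k = u (vs ! k)" for w u i
  proof -
    have "(?A *\<^sub>v w) $ i = (\<Sum>k\<in>{..<?n}. a (vs ! i) (vs ! k) * u (vs ! k))"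
      using that by (simp add: scalar_prod_def lessThan_atLeast0)
    also have "\<dots> = (\<Sum>z\<in>set vs. a (vs ! i) z * u z)"
      by (rule sum.reindex_bij_betw[OF bij])
    finally show ?thesis .
  qed
  show ?thesis
  proof
    assume "l \<in> spectrum ?A"
    then obtain w where w: "w \<in> carrier_vec ?n" "w \<noteq> 0\<^sub>v ?n" "?A *\<^sub>v w = l \<cdot>\<^sub>v w"
      by (auto simp: spectrum_def eigenvalue_def eigenvector_def)
    define u where "u y = w $ (inv_into {..<?n} ((!) vs) y)" for y
    have wu: "w $ k = u (vs ! k)" if "k < ?n" for k
      using that bij_betw_imp_inj_on[OF bij] by (simp add: u_def)
    have "\<exists>k<?n. w $ k \<noteq> 0"
    proof (rule ccontr)
      assume "\<not> ?thesis"
      then have "w = 0\<^sub>v ?n" using w(1) by (intro eq_vecI) auto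
      then show False using w(2) by simp
    qed
    then have "\<exists>y\<in>set vs. u y \<noteq> 0" using wu by (metis nth_mem)
    moreover have "(\<Sum>z\<in>set vs. a y z * u z) = l * u y" if "y \<in> set vs" for y
    proof -
      obtain i where i: "i < ?n" "y = vs ! i"
        using \<open>y \<in> set vs\<close> by (metis in_set_conv_nth)
      have "(\<Sum>z\<in>set vs. a y z * u z) = (l \<cdot>\<^sub>v w) $ i"
        using entry[OF i(1) w(1) wu] i(2) by (simp only: w(3))
      also have "\<dots> = l * u y" using i w(1) wu[OF i(1)] by simp
      finally show ?thesis .
    qed
    ultimately show ?R by blast
  next
    assume ?R
    then obtain u where u: "\<exists>y\<in>set vs. u y \<noteq> 0"
      "\<And>y. y \<in> set vs \<Longrightarrow> (\<Sum>z\<in>set vs. a y z * u z) = l * u y" by blast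
    define w where "w = Matrix.vec ?n (\<lambda>k. u (vs ! k))"
    have w: "w \<in> carrier_vec ?n" by (simp add: w_def)
    obtain k where k: "k < ?n" "u (vs ! k) \<noteq> 0" using u(1) by (metis in_set_conv_nth)
    have "w \<noteq> 0\<^sub>v ?n"
    proof
      assume "w = 0\<^sub>v ?n"
      then have "w $ k = 0" using k by simp
      then show False using k by (simp add: w_def)
    qed
    moreover have "?A *\<^sub>v w = l \<cdot>\<^sub>v w"
    proof (rule eq_vecI)
      fix i assume "i < dim_vec (l \<cdot>\<^sub>v w)"
      then have i: "i < ?n" by (simp add: w_def)
      show "(?A *\<^sub>v w) $ i = (l \<cdot>\<^sub>v w) $ i"
        using i by (subst entry[OF i w, of u]) (simp_all add: w_def u(2))
    qed (simp add: w_def)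
    ultimately show "l \<in> spectrum ?A"
      using w by (auto simp: spectrum_def eigenvalue_def eigenvector_def)
  qed
qed

section \<open>Edge sums for \<Gamma> and its iterate\<close>

lemma Gamma_eq: "Gamma G f g y = (\<Sum>z\<in>neighbors G y. (f z - f y) * (g z - g y)) / 2"
  unfolding Gamma_def laplacian_def
  by (simp add: sum_subtractf[symmetric] sum_distrib_left sum_distrib_right algebra_simps)

lemma Gamma2_eq:
  "2 * Gamma2 G f f x =
    (\<Sum>y\<in>neighbors G x. Gamma G f f y - Gamma G f f x)
      - (\<Sum>y\<in>neighbors G x. (f y - f x) * (laplacian G f y - laplacian G f x))"
  by (simp add: Gamma2_def Gamma_eq[of G "laplacian G f" f] Gamma_eq[of G f "laplacian G f"]
      laplacian_def[of G "Gamma G f f"] mult.commute)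

text \<open>\<open>laplacian\<close> and \<open>Gamma\<close> see only differences of values. This
  justifies the normalization \<open>f x = 0\<close>.\<close>

lemma Gamma2_shift: "Gamma2 G (\<lambda>z. f z - c) (\<lambda>z. f z - c) x = Gamma2 G f f x"
proof -
  have "laplacian G (\<lambda>z. f z - c) = laplacian G f"
    by (simp add: laplacian_def fun_eq_iff)
  moreover have "Gamma G (\<lambda>z. f z - c) (\<lambda>z. f z - c) = Gamma G f f"
    by (simp add: Gamma_eq fun_eq_iff)
  ultimately have "2 * Gamma2 G (\<lambda>z. f z - c) (\<lambda>z. f z - c) x = 2 * Gamma2 G f f x"
    unfolding Gamma2_eq by simp
  then show ?thesis by simp
qed

lemma graph_distance_eq_2:
  assumes "pair_bidirected_digraph G" "u \<noteq> v" "(u, v) \<notin> parcs G" "(u, w) \<in> parcs G" "(w, v) \<in> parcs G"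
  shows "graph_distance G u v = 2"
proof -
  interpret pair_bidirected_digraph G by fact
  have walk: "awalk u [(u, w), (w, v)] v"
    using assms by (auto simp: awalk_simps dest: arc_fst_in_verts arc_snd_in_verts)
  \<comment> \<open>Length 0 is excluded by \<open>u \<noteq> v\<close>, length 1 by
    nonadjacency.\<close>
  have "2 \<le> ereal (awalk_cost (\<lambda>_. 1) p)" if "awalk u p v" for p
  proof -
    obtain e e' q where "p = e # e' # q"
    proof (cases p rule: remdups_adj.cases)
      case 1 then show ?thesis using that \<open>awalk u p v\<close> \<open>u \<noteq> v\<close> by (simp add: awalk_simps)
    next
      case (2 e)
      then show ?thesis using that \<open>awalk u p v\<close> assms(3) by (cases e) (auto simp: awalk_simps)
    qed (use that in blast)
    moreover have "0 \<le> awalk_cost (\<lambda>_. 1) q" for q :: "('a \<times> 'a) list"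
      by (induction q) auto
    ultimately show ?thesis by simp
  qed
  then have "2 \<le> \<mu> (\<lambda>_. 1) u v"
    unfolding \<mu>_def by (intro INF_greatest) auto
  moreover have "\<mu> (\<lambda>_. 1) u v \<le> 2"
    using min_cost_le_walk_cost[OF walk, of "\<lambda>_. 1"] by simp
  ultimately show ?thesis by (simp add: graph_distance_def)
qed

section \<open>Amply regular graphs: common neighbors and connectedness\<close>

locale amply_regular_graph =
  fixes G :: "'a pair_pre_digraph" and n :: enat and d \<alpha> \<beta> :: nat
  assumes amply: "amply_regular G n d \<alpha> \<beta>"
    and conn: "Digraph_Component.connected (with_proj G)"
    and not_complete: "\<not> complete_graph G"
    and not_empty: "\<not> empty_graph G"
begin

abbreviation N :: "'a \<Rightarrow> 'a set" where "N \<equiv> neighbors G"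

lemma bidirected: "pair_bidirected_digraph G"
  using amply by (simp add: amply_regular_def)

lemma parcs_sym: "(u, v) \<in> parcs G \<Longrightarrow> (v, u) \<in> parcs G"
proof -
  interpret pair_bidirected_digraph G by (rule bidirected)
  show "(u, v) \<in> parcs G \<Longrightarrow> (v, u) \<in> parcs G"
    by (metis pair_sym_arcs symmetric_conv with_proj_simps(3) symD symmetric_def)
qed

lemma N_sym: "u \<in> N v \<longleftrightarrow> v \<in> N u"
  by (auto simp: neighbors_def parcs_sym)

lemma N_irrefl [simp]: "u \<notin> N u"
  using pair_loopfree_digraph.pair_no_loops[of G "(u, u)"] bidirected
  by (auto simp: neighbors_def pair_bidirected_digraph_def)

lemma N_vertices: "v \<in> N u \<Longrightarrow> u \<in> pverts G" "v \<in> N u \<Longrightarrow> v \<in> pverts G"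
  using pair_wf_digraph.in_arcsD1[of G u v] pair_wf_digraph.in_arcsD2[of G u v] bidirected
  by (auto simp: neighbors_def pair_bidirected_digraph_def pair_sym_digraph_def)

lemma finite_N [simp]: "u \<in> pverts G \<Longrightarrow> finite (N u)"
  and card_N: "u \<in> pverts G \<Longrightarrow> card (N u) = d"
  using amply by (auto simp: amply_regular_def)

lemma card_common_adjacent: "v \<in> N u \<Longrightarrow> card (N u \<inter> N v) = \<alpha>"
  using amply N_vertices[of v u] by (auto simp: amply_regular_def neighbors_def)

lemma card_common_nonadjacent:
  assumes "u \<noteq> v" "v \<notin> N u" "w \<in> N u" "w \<in> N v"
  shows "card (N u \<inter> N v) = \<beta>"
proof -
  have "graph_distance G u v = 2"
    using assms N_sym[of w v] by (intro graph_distance_eq_2[OF bidirected, of _ _ w]) (auto simp: neighbors_def)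
  then show ?thesis
    using amply N_vertices[OF assms(3)] N_vertices[OF assms(4)] by (auto simp: amply_regular_def)
qed

lemma degree_pos: "d > 0"
proof -
  obtain u v where "v \<in> N u"
    using not_empty by (auto simp: empty_graph_def neighbors_def)
  then show ?thesis
    using card_N[of u] N_vertices[of v u] finite_N[of u] by (metis card_gt_0_iff empty_iff)
qed

lemma vertices_subset_closed_set:
  assumes "u \<in> A" "u \<in> pverts G" "\<And>v. v \<in> A \<Longrightarrow> N v \<subseteq> A"
  shows "pverts G \<subseteq> A"
proof
  interpret pair_bidirected_digraph G by (rule bidirected)
  fix v assume "v \<in> pverts G"
  have "symmetric (with_proj G)" by (rule pair_sym_arcs)
  then have "u \<rightarrow>\<^sup>*\<^bsub>with_proj G\<^esub> v"
    using conn \<open>u \<in> pverts G\<close> \<open>v \<in> pverts G\<close> reachable_mk_symmetric_eq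
    by (auto simp: Digraph_Component.connected_def strongly_connected_def)
  then show "v \<in> A"
    by (induction rule: reachable_induct) (use assms in \<open>auto simp: neighbors_def\<close>)
qed

text \<open>Otherwise the ball \<open>insert x (N x)\<close> is closed under taking neighbors, so by
  connectedness it contains every vertex. With at most \<open>d + 1\<close> vertices, degree
  \<open>d\<close> forces completeness.\<close>

lemma ex_distance_2:
  assumes x: "x \<in> pverts G"
  obtains y z where "y \<in> N x" "z \<in> N y" "z \<noteq> x" "z \<notin> N x"
proof (rule ccontr)
  note found = that
  assume "\<not> thesis"
  then have "N y \<subseteq> insert x (N x)" if "y \<in> N x" for y
    using that found by blast
  then have V: "pverts G \<subseteq> insert x (N x)"
    using x by (intro vertices_subset_closed_set[of x]) auto
  then have fin: "finite (pverts G)" using x by (auto intro: finite_subset)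
  have "(u, v) \<in> parcs G" if "u \<in> pverts G" "v \<in> pverts G" "u \<noteq> v" for u v
  proof -
    have "N u \<subseteq> pverts G - {u}" using N_vertices by auto
    moreover have "card (pverts G - {u}) \<le> card (N u)"
    proof -
      have "card (pverts G) \<le> card (insert x (N x))"
        using V x by (intro card_mono) auto
      then show ?thesis using x that fin by (simp add: card_N)
    qed
    ultimately have "N u = pverts G - {u}"
      using fin by (intro card_seteq) auto
    then show ?thesis using that by (auto simp: neighbors_def)
  qed
  then show False using not_complete by (auto simp: complete_graph_def)
qed

text \<open>Makes the divisions by \<beta> genuine: some vertex at distance 2 from \<open>x\<close>
  shares a neighbor with it.\<close>

lemma beta_pos:
  assumes "x \<in> pverts G"
  shows "\<beta> > 0"
proof -
  obtain y z where yz: "y \<in> N x" "z \<in> N y" "z \<noteq> x" "z \<notin> N x"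
    using ex_distance_2[OF assms] .
  then have "card (N x \<inter> N z) = \<beta>" "y \<in> N x \<inter> N z"
    using card_common_nonadjacent[of x z y] N_sym[of z y] by auto
  then show ?thesis using assms by (metis card_gt_0_iff empty_iff finite_Int finite_N)
qed

section \<open>Counting edges and paths of length two around a vertex\<close>

definition S2 :: "'a \<Rightarrow> 'a set" where
  "S2 x = (\<Union>y\<in>N x. N y) - insert x (N x)"

text \<open>On \<^term>\<open>N x\<close> this is the adjacency operator of the subgraph induced by \<^term>\<open>N x\<close>.\<close>

definition adj_sum :: "'a \<Rightarrow> ('a \<Rightarrow> real) \<Rightarrow> 'a \<Rightarrow> real" where
  "adj_sum x v z = (\<Sum>y\<in>N x \<inter> N z. v y)"

context
  fixes x :: 'a
  assumes x: "x \<in> pverts G"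
begin

lemma finite_S2: "finite (S2 x)"
  using x N_vertices by (auto simp: S2_def)

lemma sum_neighbors_swap:
  fixes g :: "'a \<Rightarrow> 'a \<Rightarrow> real"
  assumes "finite A"
  shows "(\<Sum>y\<in>N x. \<Sum>z\<in>A \<inter> N y. g y z) = (\<Sum>z\<in>A. \<Sum>y\<in>N x \<inter> N z. g y z)"
proof -
  have "(\<Sum>y\<in>N x. \<Sum>z\<in>{z\<in>A. z \<in> N y}. g y z) = (\<Sum>z\<in>A. \<Sum>y\<in>{y\<in>N x. z \<in> N y}. g y z)"
    using assms x by (intro sum.swap_restrict) auto
  moreover have "{z\<in>A. z \<in> N y} = A \<inter> N y" "{y\<in>N x. z \<in> N y} = N x \<inter> N z" for y z
    using N_sym by auto
  ultimately show ?thesis by simp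
qed

lemma sum_sphere_split:
  fixes g :: "'a \<Rightarrow> real"
  assumes "y \<in> N x"
  shows "(\<Sum>z\<in>N y. g z) = g x + (\<Sum>z\<in>N x \<inter> N y. g z) + (\<Sum>z\<in>S2 x \<inter> N y. g z)"
proof -
  have N_y: "N y = insert x ((N x \<inter> N y) \<union> (S2 x \<inter> N y))"
    using assms N_sym by (auto simp: S2_def)
  have "sum g (insert x ((N x \<inter> N y) \<union> (S2 x \<inter> N y)))
      = g x + sum g ((N x \<inter> N y) \<union> (S2 x \<inter> N y))"
    using finite_S2 x by (intro sum.insert) (auto simp: S2_def)
  also have "sum g ((N x \<inter> N y) \<union> (S2 x \<inter> N y)) = sum g (N x \<inter> N y) + sum g (S2 x \<inter> N y)"
    using finite_S2 x by (intro sum.union_disjoint) (auto simp: S2_def)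
  finally show ?thesis using N_y by simp
qed

text \<open>\<open>sum_sphere_split\<close> for the constant 1, stated in the reals to avoid
  truncated subtraction.\<close>

lemma card_S2_neighbors:
  assumes "y \<in> N x"
  shows "real (card (S2 x \<inter> N y)) = real d - 1 - real \<alpha>"
  using sum_sphere_split[OF assms, of "\<lambda>_. 1"] card_N[of y] N_vertices[OF assms]
    card_common_adjacent[OF assms] by simp

lemma card_S2_common:
  assumes "z \<in> S2 x"
  shows "card (N x \<inter> N z) = \<beta>"
  using assms N_sym[of _ z] by (auto simp: S2_def intro: card_common_nonadjacent)

text \<open>The subgraph induced on \<open>N x\<close> is \<alpha>-regular, so each
  \<open>v z\<close> occurs \<alpha> times.\<close>

lemma sum_adj_sum:
  fixes v :: "'a \<Rightarrow> real"
  shows "(\<Sum>y\<in>N x. adj_sum x v y) = \<alpha> * (\<Sum>y\<in>N x. v y)"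
proof -
  have "(\<Sum>y\<in>N x. adj_sum x v y) = (\<Sum>z\<in>N x. \<Sum>y\<in>N x \<inter> N z. v z)"
    unfolding adj_sum_def using x by (intro sum_neighbors_swap) auto
  also have "\<dots> = (\<Sum>z\<in>N x. \<alpha> * v z)"
    by (intro sum.cong refl) (simp add: card_common_adjacent)
  finally show ?thesis by (simp add: sum_distrib_left)
qed

text \<open>On \<open>N x\<close> the matrix of common-neighbor counts is d I + \<alpha> A + \<beta>
  (J - I - A) with J all ones: distinct nonadjacent neighbors of \<open>x\<close> are joined through
  \<open>x\<close>, hence have \<beta> common neighbors.\<close>

lemma sum_card_common:
  fixes v :: "'a \<Rightarrow> real"
  assumes y: "y \<in> N x"
  shows "(\<Sum>y'\<in>N x. v y' * real (card (N y \<inter> N y')))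
    = d * v y + \<alpha> * adj_sum x v y + \<beta> * ((\<Sum>y\<in>N x. v y) - v y - adj_sum x v y)"
proof -
  let ?R = "N x - insert y (N x \<inter> N y)"
  have fin: "finite (N x)" using x by simp
  have split: "(\<Sum>y'\<in>N x. g y') = g y + (\<Sum>y'\<in>N x \<inter> N y. g y') + (\<Sum>y'\<in>?R. g y')"
    for g :: "'a \<Rightarrow> real"
  proof -
    have "sum g (N x) = sum g ?R + sum g (insert y (N x \<inter> N y))"
      using y fin by (intro sum.subset_diff) auto
    also have "sum g (insert y (N x \<inter> N y)) = g y + sum g (N x \<inter> N y)"
      using fin by (intro sum.insert) auto
    finally show ?thesis by simp
  qed
  have "(\<Sum>y'\<in>?R. v y' * real (card (N y \<inter> N y'))) = \<beta> * (\<Sum>y'\<in>?R. v y')"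
    unfolding sum_distrib_left
  proof (intro sum.cong refl)
    fix y' assume "y' \<in> ?R"
    then have "card (N y \<inter> N y') = \<beta>"
      using y N_sym by (intro card_common_nonadjacent[of _ _ x]) auto
    then show "v y' * real (card (N y \<inter> N y')) = \<beta> * v y'" by simp
  qed
  moreover have "(\<Sum>y'\<in>N x \<inter> N y. v y' * real (card (N y \<inter> N y'))) = \<alpha> * adj_sum x v y"
    unfolding adj_sum_def sum_distrib_left
    by (intro sum.cong refl) (simp add: card_common_adjacent)
  moreover have "card (N y \<inter> N y) = d"
    using card_N N_vertices[OF y] by simp
  ultimately show ?thesis
    using split[of "\<lambda>y'. v y' * real (card (N y \<inter> N y'))"] split[of v]
    by (simp add: adj_sum_def algebra_simps)
qed

text \<open>
  The right-hand side counts, with weights, the paths of length two between neighbors of \<^term>\<open>x\<close>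
  by their end points; the last two terms account for the midpoints \<^term>\<open>x\<close> and in \<^term>\<open>N x\<close>.
\<close>

lemma sum_S2_adj_sum_squared:
  fixes v :: "'a \<Rightarrow> real"
  shows "(\<Sum>z\<in>S2 x. (adj_sum x v z)\<^sup>2) =
    (real d - \<beta>) * (\<Sum>y\<in>N x. (v y)\<^sup>2) + (real \<alpha> - \<beta>) * (\<Sum>y\<in>N x. v y * adj_sum x v y)
      + (real \<beta> - 1) * (\<Sum>y\<in>N x. v y)\<^sup>2 - (\<Sum>y\<in>N x. (adj_sum x v y)\<^sup>2)"
proof -
  \<comment> \<open>The ball of radius 2 contains all neighbors of each \<open>y \<in> N x\<close>,
    so summing over it counts every path of length two; the midpoints \<open>x\<close> and in
    \<open>N x\<close> are removed at the end.\<close>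
  let ?T = "insert x (N x \<union> S2 x)"
  have fin: "finite ?T" "finite (N x)" using finite_S2 x by auto
  have T_N: "?T \<inter> N y = N y" if "y \<in> N x" for y
    using that by (auto simp: S2_def)
  have "(\<Sum>z\<in>?T. (adj_sum x v z)\<^sup>2) = (\<Sum>z\<in>?T. \<Sum>y\<in>N x \<inter> N z. v y * adj_sum x v z)"
    by (simp only: adj_sum_def power2_eq_square sum_distrib_right)
  also have "\<dots> = (\<Sum>y\<in>N x. \<Sum>z\<in>?T \<inter> N y. v y * adj_sum x v z)"
    using fin by (intro sum_neighbors_swap[symmetric]) auto
  also have "\<dots> = (\<Sum>y\<in>N x. v y * (\<Sum>z\<in>N y. adj_sum x v z))"
    by (intro sum.cong refl) (simp only: T_N sum_distrib_left)
  also have "\<dots> = (\<Sum>y\<in>N x. v y * (\<Sum>y'\<in>N x. v y' * real (card (N y \<inter> N y'))))"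
  proof -
    have "(\<Sum>z\<in>N y. adj_sum x v z) = (\<Sum>y'\<in>N x. v y' * real (card (N y \<inter> N y')))"
      if y: "y \<in> N x" for y
    proof -
      have "(\<Sum>z\<in>N y. adj_sum x v z) = (\<Sum>y'\<in>N x. \<Sum>z\<in>N y \<inter> N y'. v y')"
        unfolding adj_sum_def using N_vertices[OF y] by (intro sum_neighbors_swap[symmetric]) auto
      then show ?thesis by (simp add: mult.commute)
    qed
    then show ?thesis by simp
  qed
  also have "\<dots> = (\<Sum>y\<in>N x. v y * (d * v y + \<alpha> * adj_sum x v y
      + \<beta> * ((\<Sum>y\<in>N x. v y) - v y - adj_sum x v y)))"
    by (intro sum.cong refl) (simp only: sum_card_common)
  also have "\<dots> = (real d - \<beta>) * (\<Sum>y\<in>N x. (v y)\<^sup>2)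
      + (real \<alpha> - \<beta>) * (\<Sum>y\<in>N x. v y * adj_sum x v y) + \<beta> * (\<Sum>y\<in>N x. v y)\<^sup>2"
  proof -
    have "(\<Sum>y\<in>N x. v y * (d * v y + \<alpha> * adj_sum x v y + \<beta> * (s - v y - adj_sum x v y)))
        = (real d - \<beta>) * (\<Sum>y\<in>N x. (v y)\<^sup>2)
          + (real \<alpha> - \<beta>) * (\<Sum>y\<in>N x. v y * adj_sum x v y) + \<beta> * s * (\<Sum>y\<in>N x. v y)" for s :: real
      unfolding sum_distrib_left sum.distrib[symmetric]
      by (intro sum.cong refl) (simp add: algebra_simps power2_eq_square)
    then show ?thesis by (simp add: power2_eq_square)
  qed
  also have "(\<Sum>z\<in>?T. (adj_sum x v z)\<^sup>2)
      = (adj_sum x v x)\<^sup>2 + (\<Sum>z\<in>N x. (adj_sum x v z)\<^sup>2) + (\<Sum>z\<in>S2 x. (adj_sum x v z)\<^sup>2)"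
  proof -
    have "(\<Sum>z\<in>?T. (adj_sum x v z)\<^sup>2) = (adj_sum x v x)\<^sup>2 + (\<Sum>z\<in>N x \<union> S2 x. (adj_sum x v z)\<^sup>2)"
      using fin by (intro sum.insert) (auto simp: S2_def)
    also have "(\<Sum>z\<in>N x \<union> S2 x. (adj_sum x v z)\<^sup>2)
        = (\<Sum>z\<in>N x. (adj_sum x v z)\<^sup>2) + (\<Sum>z\<in>S2 x. (adj_sum x v z)\<^sup>2)"
      using fin by (intro sum.union_disjoint) (auto simp: S2_def)
    finally show ?thesis by simp
  qed
  \<comment> \<open>\<open>adj_sum x v x\<close> is the full sum over \<open>N x\<close>, so
    removing the midpoint \<open>x\<close> lowers the coefficient \<beta> of the squared sum to
    \<beta> - 1.\<close>
  finally show ?thesis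
    by (simp add: adj_sum_def[of x v x] algebra_simps)
qed

section \<open>The iterated \<Gamma> as a quadratic form\<close>

lemma Gamma2_sum:
  assumes "f x = 0"
  shows "2 * Gamma2 G f f x =
    (\<Sum>y\<in>N x. \<Sum>z\<in>N y. (f z - 2 * f y)\<^sup>2 / 2 - (f y)\<^sup>2 / 2)
      - d / 2 * (\<Sum>y\<in>N x. (f y)\<^sup>2) + (\<Sum>y\<in>N x. f y)\<^sup>2"
proof -
  have summand: "(\<Sum>z\<in>N y. (f z - 2 * f y)\<^sup>2 / 2 - (f y)\<^sup>2 / 2) = Gamma G f f y - f y * laplacian G f y" for y
    unfolding Gamma_eq laplacian_def sum_distrib_left sum_divide_distrib sum_subtractf[symmetric]
    by (intro sum.cong refl) (simp add: power2_eq_square field_simps)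
  have "Gamma G f f x = (\<Sum>y\<in>N x. (f y)\<^sup>2) / 2" "laplacian G f x = (\<Sum>y\<in>N x. f y)"
    using assms by (simp_all add: Gamma_eq laplacian_def power2_eq_square)
  then show ?thesis
    unfolding Gamma2_eq summand
    by (simp add: assms card_N[OF x] sum_subtractf right_diff_distrib power2_eq_square
        sum_distrib_right[symmetric])
qed

text \<open>The sums over \<open>N y\<close> are split into \<open>x\<close>, \<open>N x\<close> and
  \<open>S2 x\<close>. Only the last sum of the result involves \<open>f\<close> on
  \<open>S2 x\<close>. What completing the square leaves behind is evaluated by
  \<open>sum_S2_adj_sum_squared\<close>.\<close>

lemma Gamma2_eq_quadratic_form:
  assumes "f x = 0"
  shows "2 * Gamma2 G f f x =
    (2 + \<alpha> / 2 + (2 * real d * (real \<beta> - 2) - (real \<alpha>)\<^sup>2) / (2 * \<beta>)) * (\<Sum>y\<in>N x. (f y)\<^sup>2)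
      + 2 / \<beta> * (\<Sum>y\<in>N x. (adj_sum x f y - \<alpha> / 2 * f y)\<^sup>2)
      - (1 - 2 / \<beta>) * (\<Sum>y\<in>N x. f y)\<^sup>2
      + \<beta> / 2 * (\<Sum>z\<in>S2 x. (f z - 2 / \<beta> * adj_sum x f z)\<^sup>2)"
proof -
  have b: "real \<beta> > 0" using beta_pos[OF x] by simp
  define q where "q = (\<Sum>y\<in>N x. (f y)\<^sup>2)"
  define p where "p = (\<Sum>y\<in>N x. f y * adj_sum x f y)"
  define r where "r = (\<Sum>y\<in>N x. (adj_sum x f y)\<^sup>2)"
  define s where "s = (\<Sum>y\<in>N x. f y)"
  let ?g = "\<lambda>y z. (f z - 2 * f y)\<^sup>2 / 2 - (f y)\<^sup>2 / 2"
  have "(\<Sum>y\<in>N x. \<Sum>z\<in>N y. ?g y z)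
      = (\<Sum>y\<in>N x. ?g y x + (\<Sum>z\<in>N x \<inter> N y. ?g y z) + (\<Sum>z\<in>S2 x \<inter> N y. ?g y z))"
    by (intro sum.cong refl sum_sphere_split)
  also have "\<dots> = (\<Sum>y\<in>N x. ?g y x) + (\<Sum>y\<in>N x. \<Sum>z\<in>N x \<inter> N y. ?g y z)
      + (\<Sum>y\<in>N x. \<Sum>z\<in>S2 x \<inter> N y. ?g y z)"
    by (simp only: sum.distrib)
  also have "(\<Sum>y\<in>N x. ?g y x) = 3 / 2 * q"
    unfolding q_def sum_distrib_left using assms by (intro sum.cong refl) (simp add: power2_eq_square)
  also have "(\<Sum>y\<in>N x. \<Sum>z\<in>N x \<inter> N y. ?g y z) = 2 * \<alpha> * q - 2 * p"
  proof -
    have "(\<Sum>y\<in>N x. \<Sum>z\<in>N x \<inter> N y. ?g y z)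
        = (\<Sum>y\<in>N x. adj_sum x (\<lambda>z. (f z)\<^sup>2) y / 2 - 2 * (f y * adj_sum x f y) + 3 / 2 * \<alpha> * (f y)\<^sup>2)"
    proof (intro sum.cong refl)
      fix y assume y: "y \<in> N x"
      have "(\<Sum>z\<in>N x \<inter> N y. ?g y z)
          = (\<Sum>z\<in>N x \<inter> N y. (f z)\<^sup>2 / 2 - 2 * f y * f z + 3 / 2 * (f y)\<^sup>2)"
        by (intro sum.cong refl) (simp add: power2_eq_square field_simps)
      also have "\<dots> = adj_sum x (\<lambda>z. (f z)\<^sup>2) y / 2 - 2 * (f y * adj_sum x f y) + 3 / 2 * \<alpha> * (f y)\<^sup>2"
        by (simp add: sum.distrib sum_subtractf adj_sum_def sum_distrib_left sum_divide_distrib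
            card_common_adjacent[OF y] mult.assoc)
      finally show "(\<Sum>z\<in>N x \<inter> N y. ?g y z) = \<dots>" .
    qed
    also have "\<dots> = (\<Sum>y\<in>N x. adj_sum x (\<lambda>z. (f z)\<^sup>2) y) / 2 - 2 * p + 3 / 2 * \<alpha> * q"
      by (simp only: sum.distrib sum_subtractf sum_distrib_left sum_divide_distrib p_def q_def)
    finally show ?thesis by (simp add: sum_adj_sum[of "\<lambda>z. (f z)\<^sup>2"] flip: q_def)
  qed
  also have "(\<Sum>y\<in>N x. \<Sum>z\<in>S2 x \<inter> N y. ?g y z)
      = \<beta> / 2 * (\<Sum>z\<in>S2 x. (f z - 2 / \<beta> * adj_sum x f z)\<^sup>2)
        + 3 / 2 * (real d - 1 - \<alpha>) * q - 2 / \<beta> * (\<Sum>z\<in>S2 x. (adj_sum x f z)\<^sup>2)"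
  proof -
    \<comment> \<open>The part depending on \<open>y\<close> alone is counted by
      \<open>card_S2_neighbors\<close>; the rest is regrouped by \<open>z\<close>, where \<beta>
      terms meet and the square can be completed.\<close>
    have "(\<Sum>y\<in>N x. \<Sum>z\<in>S2 x \<inter> N y. ?g y z)
        = (\<Sum>y\<in>N x. \<Sum>z\<in>S2 x \<inter> N y. (f z)\<^sup>2 / 2 - 2 * f z * f y)
          + (\<Sum>y\<in>N x. \<Sum>z\<in>S2 x \<inter> N y. 3 / 2 * (f y)\<^sup>2)"
      unfolding sum.distrib[symmetric]
      by (intro sum.cong refl) (simp add: power2_eq_square field_simps)
    also have "(\<Sum>y\<in>N x. \<Sum>z\<in>S2 x \<inter> N y. 3 / 2 * (f y)\<^sup>2) = 3 / 2 * (real d - 1 - \<alpha>) * q"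
      unfolding q_def sum_distrib_left by (intro sum.cong refl) (simp add: card_S2_neighbors)
    also have "(\<Sum>y\<in>N x. \<Sum>z\<in>S2 x \<inter> N y. (f z)\<^sup>2 / 2 - 2 * f z * f y)
        = (\<Sum>z\<in>S2 x. \<Sum>y\<in>N x \<inter> N z. (f z)\<^sup>2 / 2 - 2 * f z * f y)"
      by (rule sum_neighbors_swap[OF finite_S2])
    also have "\<dots> = (\<Sum>z\<in>S2 x. \<beta> / 2 * (f z - 2 / \<beta> * adj_sum x f z)\<^sup>2 - 2 / \<beta> * (adj_sum x f z)\<^sup>2)"
    proof (intro sum.cong refl)
      fix z assume z: "z \<in> S2 x"
      have "(\<Sum>y\<in>N x \<inter> N z. (f z)\<^sup>2 / 2 - 2 * f z * f y) = \<beta> / 2 * (f z)\<^sup>2 - 2 * f z * adj_sum x f z"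
        by (simp add: sum_subtractf adj_sum_def card_S2_common[OF z] flip: sum_distrib_left)
      also have "\<dots> = \<beta> / 2 * (f z - 2 / \<beta> * adj_sum x f z)\<^sup>2 - 2 / \<beta> * (adj_sum x f z)\<^sup>2"
        using b by (simp add: power2_eq_square field_simps)
      finally show "(\<Sum>y\<in>N x \<inter> N z. (f z)\<^sup>2 / 2 - 2 * f z * f y) = \<dots>" .
    qed
    finally show ?thesis
      by (simp only: sum_subtractf sum_distrib_left)
  qed
  finally have Gamma2_q: "2 * Gamma2 G f f x = 3 / 2 * q + (2 * \<alpha> * q - 2 * p)
      + (\<beta> / 2 * (\<Sum>z\<in>S2 x. (f z - 2 / \<beta> * adj_sum x f z)\<^sup>2)
        + 3 / 2 * (real d - 1 - \<alpha>) * q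
        - 2 / \<beta> * ((real d - \<beta>) * q + (real \<alpha> - \<beta>) * p + (real \<beta> - 1) * s\<^sup>2 - r))
      - d / 2 * q + s\<^sup>2"
    unfolding Gamma2_sum[of f, OF assms] sum_S2_adj_sum_squared q_def p_def r_def s_def by simp
  have shifted: "(\<Sum>y\<in>N x. (adj_sum x f y - \<alpha> / 2 * f y)\<^sup>2) = r - \<alpha> * p + (\<alpha> / 2)\<^sup>2 * q"
    unfolding q_def p_def r_def sum_distrib_left sum_subtractf[symmetric] sum.distrib[symmetric]
    by (intro sum.cong refl) (simp add: power2_eq_square field_simps)
  define T where "T = (\<Sum>z\<in>S2 x. (f z - 2 / \<beta> * adj_sum x f z)\<^sup>2)"
  show ?thesis
    unfolding shifted Gamma2_q q_def[symmetric] s_def[symmetric] T_def[symmetric]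
    using b by (simp add: power2_eq_square field_simps)
qed

lemma adj_sum_const:
  fixes t :: real
  shows "y \<in> N x \<Longrightarrow> adj_sum x (\<lambda>_. t) y = \<alpha> * t"
  by (simp add: adj_sum_def card_common_adjacent)

text \<open>
  For \<open>\<beta> = 1\<close> adjacency is transitive on \<^term>\<open>N x\<close>, so \<^term>\<open>N x\<close> induces a disjoint union of
  cliques. As the graph is not complete there are at least two of them, and the eigenvector is the
  indicator of one of them minus its mean.
\<close>

lemma alpha_eigenvector_sum_0:
  assumes "\<beta> = 1"
  obtains v :: "'a \<Rightarrow> real" where "\<exists>y\<in>N x. v y \<noteq> 0" "(\<Sum>y\<in>N x. v y) = 0"
    "\<And>y. y \<in> N x \<Longrightarrow> adj_sum x v y = \<alpha> * v y"
proof -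
  obtain y z where yz: "y \<in> N x" "z \<in> N y" "z \<noteq> x" "z \<notin> N x"
    using ex_distance_2[OF x] .
  define C where "C = insert y (N x \<inter> N y)"
  have C: "C \<subseteq> N x" "finite C" "card C = \<alpha> + 1"
    using x yz card_common_adjacent[of y x] by (auto simp: C_def)
  \<comment> \<open>\<open>x\<close> and \<open>z\<close> are neighbors of \<open>y\<close> outside
    \<open>N x\<close>, so \<open>C\<close> has fewer than \<open>d\<close> elements; this keeps
    \<open>v y\<close> nonzero.\<close>
  have "insert x (insert z (N x \<inter> N y)) \<subseteq> N y"
    using yz N_sym by auto
  then have "card (insert x (insert z (N x \<inter> N y))) \<le> d"
    using N_vertices[OF yz(1)] by (metis card_N card_mono finite_N)
  then have d: "\<alpha> + 1 < d"
    using x yz card_common_adjacent[of y x] by simp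
  \<comment> \<open>Otherwise \<open>x\<close> and \<open>b\<close> would be two common neighbors of
    the nonadjacent \<open>a\<close> and \<open>c\<close>.\<close>
  have trans: "c \<in> N a" if "a \<in> N x" "b \<in> N x" "c \<in> N x" "b \<in> N a" "c \<in> N b" "c \<noteq> a" for a b c
  proof (rule ccontr)
    assume "c \<notin> N a"
    then have "card (N a \<inter> N c) = 1"
      using that \<open>\<beta> = 1\<close> N_sym[of x] by (metis card_common_nonadjacent)
    moreover have "x \<in> N a \<inter> N c" "b \<in> N a \<inter> N c" using that N_sym by auto
    ultimately have "b = x" by (metis card_1_singletonE singletonD)
    then show False using that by simp
  qed
  \<comment> \<open>\<open>(\<alpha> + 1) / d\<close> is the mean over \<open>N x\<close> of the
    indicator of \<open>C\<close>.\<close>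
  define v :: "'a \<Rightarrow> real" where "v i = of_bool (i \<in> C) - (\<alpha> + 1) / d" for i
  have sum_C: "(\<Sum>i\<in>A. of_bool (i \<in> C)) = real (card (A \<inter> C))" if "finite A" for A
    using that by (simp add: of_bool_def sum.If_cases Int_def)
  have "v y \<noteq> 0" using d by (simp add: v_def C_def)
  moreover have "(\<Sum>i\<in>N x. v i) = 0"
  proof -
    have "N x \<inter> C = C" using C by auto
    then show ?thesis
      using x d C by (simp add: v_def sum_subtractf sum_C card_N)
  qed
  moreover have "adj_sum x v i = \<alpha> * v i" if i: "i \<in> N x" for i
  proof -
    \<comment> \<open>By transitivity no edge inside \<open>N x\<close> leaves
      \<open>C\<close>.\<close>
    have "N x \<inter> N i \<inter> C = (if i \<in> C then N x \<inter> N i else {})"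
    proof (cases "i \<in> C")
      case True
      have "j \<in> C" if "j \<in> N x \<inter> N i" for j
        using that True trans[of y i j] yz i by (auto simp: C_def)
      then show ?thesis using True by auto
    next
      case False
      have "j \<notin> C" if "j \<in> N x \<inter> N i" for j
        using that False trans[of y j i] yz i N_sym[of i j] by (auto simp: C_def)
      then show ?thesis using False by auto
    qed
    then show ?thesis
      using x i by (simp add: adj_sum_def v_def sum_subtractf sum_C card_common_adjacent algebra_simps)
  qed
  ultimately show thesis
    using yz(1) by (intro that[of v] bexI[of _ y]) simp_all
qed

section \<open>The curvature from an eigenvalue \<open>l\<close> nearest to \<alpha>/2\<close>

context
  fixes l :: real and u :: "'a \<Rightarrow> real"
  assumes u_nonzero: "\<exists>y\<in>N x. u y \<noteq> 0"
    and u_eigenvector: "\<And>y. y \<in> N x \<Longrightarrow> adj_sum x u y = l * u y"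
    and l_least: "\<And>v :: 'a \<Rightarrow> real. (l - \<alpha> / 2)\<^sup>2 * (\<Sum>y\<in>N x. (v y)\<^sup>2)
      \<le> (\<Sum>y\<in>N x. (adj_sum x v y - \<alpha> / 2 * v y)\<^sup>2)"
begin

text \<open>The quadratic form per unit of squared norm at an \<open>l\<close>-eigenfunction of sum
  0, minus its value \<open>2 + \<alpha> / 2\<close> at the constants.\<close>

definition gap :: real where
  "gap = (2 * real d * (real \<beta> - 2) - (real \<alpha>)\<^sup>2) / (2 * real \<beta>) + 2 / real \<beta> * (l - real \<alpha> / 2)\<^sup>2"

definition kappa :: real where
  "kappa = 2 + real \<alpha> / 2 + negative_part gap"

text \<open>On \<open>N x\<close> write \<open>f\<close> as \<open>w + t\<close> with
  \<open>t\<close> its mean. A multiplies constants by \<alpha> and preserves sum 0, so no cross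
  terms survive and each part is bounded separately; the squares over \<open>S2 x\<close> are
  dropped.\<close>

lemma Gamma2_lower_bound:
  assumes "f x = 0"
  shows "2 * Gamma2 G f f x \<ge> kappa * (\<Sum>y\<in>N x. (f y)\<^sup>2)"
proof -
  have b: "real \<beta> > 0" using beta_pos[OF x] by simp
  have d: "real d > 0" using degree_pos by simp
  define s where "s = (\<Sum>y\<in>N x. f y)"
  define t where "t = s / d"
  define w where "w y = f y - t" for y
  define W where "W = (\<Sum>y\<in>N x. (w y)\<^sup>2)"
  define P where "P = (\<Sum>y\<in>N x. (adj_sum x w y - \<alpha> / 2 * w y)\<^sup>2)"
  have sum_w: "(\<Sum>y\<in>N x. w y) = 0"
    using d x by (simp add: w_def t_def sum_subtractf card_N s_def)
  have sum_shift: "(\<Sum>y\<in>N x. (g y + a)\<^sup>2) = (\<Sum>y\<in>N x. (g y)\<^sup>2) + d * a\<^sup>2"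
    if "(\<Sum>y\<in>N x. g y) = 0" for g :: "'a \<Rightarrow> real" and a :: real
  proof -
    have "(\<Sum>y\<in>N x. (g y + a)\<^sup>2) = (\<Sum>y\<in>N x. (g y)\<^sup>2 + 2 * a * g y + a\<^sup>2)"
      by (intro sum.cong refl) (simp add: power2_sum)
    also have "\<dots> = (\<Sum>y\<in>N x. (g y)\<^sup>2) + 2 * a * (\<Sum>y\<in>N x. g y) + d * a\<^sup>2"
      using x by (simp add: sum.distrib card_N flip: sum_distrib_left)
    finally have "(\<Sum>y\<in>N x. (g y + a)\<^sup>2) = \<dots>" .
    then show ?thesis using that by simp
  qed
  have q: "(\<Sum>y\<in>N x. (f y)\<^sup>2) = W + d * t\<^sup>2"
    using sum_shift[OF sum_w, of t] by (simp add: w_def W_def)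
  have "(\<Sum>y\<in>N x. (adj_sum x f y - \<alpha> / 2 * f y)\<^sup>2)
      = (\<Sum>y\<in>N x. ((adj_sum x w y - \<alpha> / 2 * w y) + \<alpha> / 2 * t)\<^sup>2)"
  proof (intro sum.cong refl arg_cong[of _ _ "\<lambda>r. r\<^sup>2"])
    fix y assume y: "y \<in> N x"
    have adj_w: "adj_sum x w y = adj_sum x f y - \<alpha> * t"
      using adj_sum_const[OF y, of t] by (simp add: adj_sum_def w_def sum_subtractf)
    then show "adj_sum x f y - \<alpha> / 2 * f y = (adj_sum x w y - \<alpha> / 2 * w y) + \<alpha> / 2 * t"
      by (simp add: adj_w w_def[of y] field_simps)
  qed
  also have "\<dots> = P + d * (\<alpha> / 2 * t)\<^sup>2"
    unfolding P_def
    by (rule sum_shift) (simp add: sum_subtractf sum_adj_sum sum_w flip: sum_distrib_left sum_divide_distrib)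
  finally have p: "(\<Sum>y\<in>N x. (adj_sum x f y - \<alpha> / 2 * f y)\<^sup>2) = P + d * (\<alpha> / 2 * t)\<^sup>2" .
  have s: "s = d * t" using d by (simp add: t_def)
  let ?c = "2 + \<alpha> / 2 + (2 * real d * (real \<beta> - 2) - (real \<alpha>)\<^sup>2) / (2 * \<beta>)"
  have "0 \<le> \<beta> / 2 * (\<Sum>z\<in>S2 x. (f z - 2 / \<beta> * adj_sum x f z)\<^sup>2)"
    using b by (intro mult_nonneg_nonneg sum_nonneg) auto
  then have "2 * Gamma2 G f f x
      \<ge> ?c * (W + d * t\<^sup>2) + 2 / \<beta> * (P + d * (\<alpha> / 2 * t)\<^sup>2) - (1 - 2 / \<beta>) * (d * t)\<^sup>2"
    unfolding Gamma2_eq_quadratic_form[of f, OF assms] p q s_def[symmetric] s by linarith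
  \<comment> \<open>In the constant part the contributions of d(\<beta> - 2)/\<beta> and \<alpha>^2
    cancel, leaving \<open>2 + \<alpha> / 2\<close>.\<close>
  also have "?c * (W + d * t\<^sup>2) + 2 / \<beta> * (P + d * (\<alpha> / 2 * t)\<^sup>2) - (1 - 2 / \<beta>) * (d * t)\<^sup>2
      = (?c * W + 2 / \<beta> * P) + (2 + \<alpha> / 2) * (d * t\<^sup>2)"
    using b by (simp add: power2_eq_square field_simps)
  finally have "2 * Gamma2 G f f x \<ge> (?c * W + 2 / \<beta> * P) + (2 + \<alpha> / 2) * (d * t\<^sup>2)" .
  moreover have "2 / \<beta> * P \<ge> 2 / \<beta> * ((l - \<alpha> / 2)\<^sup>2 * W)"
    unfolding P_def W_def using b by (intro mult_left_mono l_least) auto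
  moreover have "kappa * W \<le> (2 + \<alpha> / 2 + gap) * W"
    by (intro mult_right_mono) (auto simp: kappa_def negative_part_def W_def sum_nonneg)
  moreover have "kappa * (d * t\<^sup>2) \<le> (2 + \<alpha> / 2) * (d * t\<^sup>2)"
    by (intro mult_right_mono) (auto simp: kappa_def negative_part_def)
  moreover have "(2 + \<alpha> / 2 + gap) * W = ?c * W + 2 / \<beta> * ((l - \<alpha> / 2)\<^sup>2 * W)"
    by (simp add: gap_def algebra_simps)
  moreover have "kappa * (W + d * t\<^sup>2) = kappa * W + kappa * (d * t\<^sup>2)"
    by (simp add: algebra_simps)
  ultimately show ?thesis unfolding q by linarith
qed

text \<open>Provides equality in the lower bound: a constant if \<open>gap \<ge> 0\<close>,
  otherwise an \<open>l\<close>-eigenfunction of sum 0.\<close>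

lemma extremal_neighbor_function:
  obtains v :: "'a \<Rightarrow> real" where "\<exists>y\<in>N x. v y \<noteq> 0"
    "(2 + \<alpha> / 2 + (2 * real d * (real \<beta> - 2) - (real \<alpha>)\<^sup>2) / (2 * \<beta>)) * (\<Sum>y\<in>N x. (v y)\<^sup>2)
      + 2 / \<beta> * (\<Sum>y\<in>N x. (adj_sum x v y - \<alpha> / 2 * v y)\<^sup>2)
      - (1 - 2 / \<beta>) * (\<Sum>y\<in>N x. v y)\<^sup>2
     = kappa * (\<Sum>y\<in>N x. (v y)\<^sup>2)"
proof (cases "gap \<ge> 0")
  case True
  have b: "real \<beta> > 0" using beta_pos[OF x] by simp
  have "N x \<noteq> {}" using card_N[OF x] degree_pos by auto
  moreover have "(\<Sum>y\<in>N x. (adj_sum x (\<lambda>_. 1) y - \<alpha> / 2 * 1)\<^sup>2) = d * (\<alpha> / 2)\<^sup>2"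
  proof -
    have "(\<Sum>y\<in>N x. (adj_sum x (\<lambda>_. 1) y - \<alpha> / 2 * 1)\<^sup>2) = (\<Sum>y\<in>N x. (\<alpha> / 2)\<^sup>2)"
      by (intro sum.cong refl) (simp add: adj_sum_const)
    then show ?thesis using x by (simp add: card_N)
  qed
  ultimately show thesis
    using True b x by (intro that[of "\<lambda>_. 1"])
      (auto simp: card_N kappa_def negative_part_def power2_eq_square field_simps)
next
  case False
  have b: "real \<beta> > 0" using beta_pos[OF x] by simp
  \<comment> \<open>For \<open>l \<noteq> \<alpha>\<close> the eigenfunction \<open>u\<close> has
    sum 0 already. For \<open>l = \<alpha>\<close> a negative gap forces \<beta> = 1, and the clique
    construction supplies one.\<close>
  obtain v where v: "\<exists>y\<in>N x. v y \<noteq> 0" "\<And>y. y \<in> N x \<Longrightarrow> adj_sum x v y = l * v y"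
    "(\<Sum>y\<in>N x. v y) = 0"
  proof (cases "l = \<alpha>")
    case l: True
    have "gap = d * (real \<beta> - 2) / \<beta>"
      unfolding gap_def unfolding l using b by (simp add: power2_eq_square field_simps)
    then have "real \<beta> < 2"
      using False by (intro ccontr[of "real \<beta> < 2"]) simp
    then have "\<beta> = 1" using b by linarith
    then show thesis using alpha_eigenvector_sum_0 that l by metis
  next
    case l: False
    have "\<alpha> * (\<Sum>y\<in>N x. u y) = (\<Sum>y\<in>N x. l * u y)"
      using u_eigenvector by (simp flip: sum_adj_sum)
    then have "(\<Sum>y\<in>N x. u y) = 0" using l by (simp flip: sum_distrib_left)
    then show thesis using that u_nonzero u_eigenvector by blast
  qed
  have "(\<Sum>y\<in>N x. (adj_sum x v y - \<alpha> / 2 * v y)\<^sup>2) = (l - \<alpha> / 2)\<^sup>2 * (\<Sum>y\<in>N x. (v y)\<^sup>2)"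
    unfolding sum_distrib_left
    by (intro sum.cong refl) (simp add: v(2) power2_eq_square algebra_simps)
  moreover have "kappa = 2 + \<alpha> / 2 + gap"
    using False by (simp add: kappa_def negative_part_def)
  ultimately show thesis
    using v by (intro that[of v]) (simp_all add: gap_def algebra_simps)
qed

lemma curvature_eq_kappa: "Bakry_Emery_curvature G x = ereal kappa"
  unfolding Bakry_Emery_curvature_def
proof (rule Sup_eqI)
  have Gamma_x: "2 * Gamma G f f x = (\<Sum>y\<in>N x. (f y - f x)\<^sup>2)" for f
    by (simp add: Gamma_eq power2_eq_square)
  {
    fix y assume "y \<in> {ereal K |K. \<forall>f. Gamma2 G f f x \<ge> K * Gamma G f f x}"
    then obtain K where K: "y = ereal K" "\<And>f. Gamma2 G f f x \<ge> K * Gamma G f f x"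
      by blast
    obtain v where v: "\<exists>y\<in>N x. v y \<noteq> 0"
      "(2 + \<alpha> / 2 + (2 * real d * (real \<beta> - 2) - (real \<alpha>)\<^sup>2) / (2 * \<beta>)) * (\<Sum>y\<in>N x. (v y)\<^sup>2)
        + 2 / \<beta> * (\<Sum>y\<in>N x. (adj_sum x v y - \<alpha> / 2 * v y)\<^sup>2)
        - (1 - 2 / \<beta>) * (\<Sum>y\<in>N x. v y)\<^sup>2
       = kappa * (\<Sum>y\<in>N x. (v y)\<^sup>2)"
      by (rule extremal_neighbor_function)
    \<comment> \<open>The values \<open>2 / \<beta> * adj_sum x v z\<close> make every completed
      square over \<open>S2 x\<close> vanish.\<close>
    define f where "f z = (if z = x then 0 else if z \<in> N x then v z else 2 / \<beta> * adj_sum x v z)" for z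
    have f: "f x = 0" "\<And>z. z \<in> N x \<Longrightarrow> f z = v z" by (auto simp: f_def)
    have adj_f: "adj_sum x f z = adj_sum x v z" for z
      using f(2) by (simp add: adj_sum_def)
    have "(\<Sum>z\<in>S2 x. (f z - 2 / \<beta> * adj_sum x f z)\<^sup>2) = 0"
      by (intro sum.neutral) (auto simp: adj_f f_def S2_def)
    then have "2 * Gamma2 G f f x = kappa * (\<Sum>y\<in>N x. (v y)\<^sup>2)"
      using v(2) f(2) by (simp add: Gamma2_eq_quadratic_form[of f, OF f(1)] adj_f)
    moreover have "2 * Gamma G f f x = (\<Sum>y\<in>N x. (v y)\<^sup>2)"
      using f by (simp add: Gamma_x)
    ultimately have "K * (\<Sum>y\<in>N x. (v y)\<^sup>2) \<le> kappa * (\<Sum>y\<in>N x. (v y)\<^sup>2)"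
      using K(2)[of f] by (metis mult.left_commute mult_le_cancel_left_pos zero_less_numeral)
    moreover have "(\<Sum>y\<in>N x. (v y)\<^sup>2) > 0"
      using v(1) x by (auto intro: sum_pos2)
    ultimately show "y \<le> ereal kappa" using K(1) by simp
  next
    fix y assume y: "\<And>z. z \<in> {ereal K |K. \<forall>f. Gamma2 G f f x \<ge> K * Gamma G f f x} \<Longrightarrow> z \<le> y"
    have "Gamma2 G f f x \<ge> kappa * Gamma G f f x" for f
    proof -
      have "2 * Gamma2 G f f x \<ge> kappa * (2 * Gamma G f f x)"
        using Gamma2_lower_bound[of "\<lambda>z. f z - f x"] by (simp add: Gamma2_shift Gamma_x)
      then show ?thesis by simp
    qed
    then show "ereal kappa \<le> y" by (intro y) blast
  }
qed

end

end

end

section \<open>Passage to the adjacency matrix\<close>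

lemma (in amply_regular_graph) sum_adjacency:
  fixes u :: "'a \<Rightarrow> real"
  assumes "x \<in> pverts G"
  shows "(\<Sum>z\<in>N x. (if z \<in> N y then 1 else 0) * u z) = adj_sum x u y"
  using assms by (simp add: adj_sum_def sum.inter_restrict if_distrib[of "\<lambda>t. t * _"] cong: if_cong)

theorem theorem4p3:
  fixes G :: "'a pair_pre_digraph"
    and n :: enat
    and d \<alpha> \<beta> :: nat
    and x :: 'a
    and vs :: "'a list"
  assumes "amply_regular G n d \<alpha> \<beta>"
    and "Digraph_Component.connected (with_proj G)"
    and "\<not> complete_graph G"
    and "\<not> empty_graph G"
    and "x \<in> pverts G"
    and "distinct vs"
    and "set vs = neighbors G x"
  shows "Bakry_Emery_curvature G x =
    ereal (2 + real \<alpha> / 2 +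
      negative_part ((2 * real d * (real \<beta> - 2) - (real \<alpha>)\<^sup>2) / (2 * real \<beta>) +
        2 / real \<beta> *
          Min ((\<lambda>l. (l - real \<alpha> / 2)\<^sup>2) `
            spectrum (adjacency_matrix (with_proj G \<restriction> neighbors G x) vs))))"
proof -
  interpret amply_regular_graph G n d \<alpha> \<beta> by unfold_locales fact+
  note x = \<open>x \<in> pverts G\<close>
  let ?A = "adjacency_matrix (with_proj G \<restriction> N x) vs"
  have A_eq: "?A = Matrix.mat (length vs) (length vs) (\<lambda>(i, j). if vs ! j \<in> N (vs ! i) then 1 else 0)"
    unfolding adjacency_matrix_def
  proof (intro cong_mat refl)
    fix i j assume "i < length vs" "j < length vs"
    then have "vs ! i \<in> N x" "vs ! j \<in> N x" using \<open>set vs = N x\<close> by (metis nth_mem)+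
    then have "(vs ! i, vs ! j) \<in> arcs_ends (with_proj G \<restriction> N x) \<longleftrightarrow> vs ! j \<in> N (vs ! i)"
      by (auto simp: arcs_ends_def arc_to_ends_def neighbors_def)
    then show "(case (i, j) of (i, j) \<Rightarrow> if (vs ! i, vs ! j) \<in> arcs_ends (with_proj G \<restriction> N x) then 1 else (0::real))
        = (case (i, j) of (i, j) \<Rightarrow> if vs ! j \<in> N (vs ! i) then 1 else 0)" by simp
  qed
  have spectrum_iff: "l \<in> spectrum ?A \<longleftrightarrow>
      (\<exists>u. (\<exists>y\<in>N x. u y \<noteq> 0) \<and> (\<forall>y\<in>N x. adj_sum x u y = l * u y))" for l
    unfolding A_eq
    using spectrum_mat_nth_iff[OF \<open>distinct vs\<close>, of l "\<lambda>y z. if z \<in> N y then 1 else 0"]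
    by (simp only: \<open>set vs = N x\<close> sum_adjacency[OF x])
  \<comment> \<open>The kernel of A - \<alpha>/2; its eigenvalue \<open>r\<close> of least square is
    shifted back to \<open>l = r + \<alpha> / 2\<close>.\<close>
  define b :: "'a \<Rightarrow> 'a \<Rightarrow> real" where
    "b y z = (if z \<in> N y then 1 else 0) - (if z = y then \<alpha> / 2 else 0)" for y z
  have b_sum: "(\<Sum>z\<in>N x. b y z * v z) = adj_sum x v y - \<alpha> / 2 * v y" if "y \<in> N x" for v y
  proof -
    have "(\<Sum>z\<in>N x. b y z * v z)
        = (\<Sum>z\<in>N x. (if z \<in> N y then 1 else 0) * v z) - (\<Sum>z\<in>N x. if z = y then \<alpha> / 2 * v z else 0)"
      unfolding sum_subtractf[symmetric] by (intro sum.cong refl) (simp add: b_def left_diff_distrib)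
    then show ?thesis using x that by (simp add: sum_adjacency)
  qed
  have "N x \<noteq> {}" using card_N[OF x] degree_pos by auto
  moreover have "b y z = b z y" for y z using N_sym[of y z] by (simp add: b_def)
  ultimately obtain r u where u: "\<exists>y\<in>N x. u y \<noteq> 0"
      "\<And>y. y \<in> N x \<Longrightarrow> (\<Sum>z\<in>N x. b y z * u z) = r * u y"
    and least: "\<And>v. r\<^sup>2 * (\<Sum>y\<in>N x. (v y)\<^sup>2) \<le> (\<Sum>y\<in>N x. (\<Sum>z\<in>N x. b y z * v z)\<^sup>2)"
    by (rule symmetric_least_square_eigenvalue[of "N x" b, OF finite_N[OF x]]) auto
  define l where "l = r + \<alpha> / 2"
  have eig: "adj_sum x u y = l * u y" if "y \<in> N x" for y
    using u(2)[OF that] b_sum[OF that, of u] by (simp add: l_def algebra_simps)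
  have l_least: "(l - \<alpha> / 2)\<^sup>2 * (\<Sum>y\<in>N x. (v y)\<^sup>2)
      \<le> (\<Sum>y\<in>N x. (adj_sum x v y - \<alpha> / 2 * v y)\<^sup>2)" for v
    using least[of v] by (simp add: l_def b_sum)
  \<comment> \<open>Attained at \<open>l\<close>; for any other eigenvalue, \<open>l_least\<close>
    at its eigenfunction compares two multiples of the same positive squared norm.\<close>
  have "Min ((\<lambda>l. (l - \<alpha> / 2)\<^sup>2) ` spectrum ?A) = (l - \<alpha> / 2)\<^sup>2"
  proof (rule Min_eqI)
    show "finite ((\<lambda>l. (l - \<alpha> / 2)\<^sup>2) ` spectrum ?A)"
      by (intro finite_imageI card_finite_spectrum(1)[of _ "length vs"]) (simp add: adjacency_matrix_def)
    show "(l - \<alpha> / 2)\<^sup>2 \<in> (\<lambda>l. (l - \<alpha> / 2)\<^sup>2) ` spectrum ?A"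
      using u(1) eig spectrum_iff by blast
  next
    fix m assume "m \<in> (\<lambda>l. (l - \<alpha> / 2)\<^sup>2) ` spectrum ?A"
    then obtain k v where m: "m = (k - \<alpha> / 2)\<^sup>2" and v: "\<exists>y\<in>N x. v y \<noteq> 0"
      "\<forall>y\<in>N x. adj_sum x v y = k * v y"
      using spectrum_iff by blast
    have "(\<Sum>y\<in>N x. (adj_sum x v y - \<alpha> / 2 * v y)\<^sup>2) = m * (\<Sum>y\<in>N x. (v y)\<^sup>2)"
      unfolding sum_distrib_left m
      by (intro sum.cong refl) (simp add: v(2) power2_eq_square algebra_simps)
    then have "(l - \<alpha> / 2)\<^sup>2 * (\<Sum>y\<in>N x. (v y)\<^sup>2) \<le> m * (\<Sum>y\<in>N x. (v y)\<^sup>2)"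
      using l_least[of v] by simp
    moreover have "(\<Sum>y\<in>N x. (v y)\<^sup>2) > 0"
      using v(1) x by (auto intro: sum_pos2)
    ultimately show "(l - \<alpha> / 2)\<^sup>2 \<le> m" by simp
  qed
  then show ?thesis
    using curvature_eq_kappa[OF x u(1) eig l_least] kappa_def[OF x u(1) eig l_least]
      gap_def[OF x u(1) eig l_least]
    by simp
qed

end
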